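(* Let $p$ be a prime number, let $q$ be an integer with $1<q<p$, and let $u\in\mathbf{Z}_p$. Then $u$ is rational (i.e. $u\in\mathbf{Q}$) if and only if the sequence $(g_{p,q}^n(u))_{n\in\mathbf{N}}$ is ultimately periodic.
   Context: $\mathbf{N}=\{0,1,2,\dots\}$. For $x\in\mathbf{Z}_p$, $\epsilon_0(x)\in\{0,1,\dots,p-1\}$ is the unique element with $\epsilon_0(x)\equiv x \pmod p$. The map $g_{p,q}:\mathbf{Z}_p\to\mathbf{Z}_p$ is defined by $g_{p,q}(x)=\frac{x}{p}$ if $p\mid x$, and $g_{p,q}(x)=\frac{qx+\epsilon_0(-qx)}{p}$ otherwise. $g_{p,q}^n$ denotes the $n$-th iterate. A sequence $(x_n)_{n\in\mathbf{N}}$ is ultimately periodic if there is $n_0\in\mathbf{N}$ such that $(x_{n_0+n})_{n\in\mathbf{N}}$ is periodic. *)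

theory Defs
  imports "HOL-Computational_Algebra.Primes" "HOL-Algebra.Algebra"
begin

(* so that "prime" means primality of numbers *)
hide_const (open) Divisibility.prime

section \<open>The ring of p-adic integers\<close>

text \<open>
  The inverse limit of the rings of integers modulo \<open>p ^ n\<close>: a p-adic integer is represented by
  the sequence of its least nonnegative residues modulo \<open>p ^ n\<close>.
\<close>

definition padic_int :: "int \<Rightarrow> (nat \<Rightarrow> int) ring" where
  "padic_int p =
    \<lparr>carrier = {x. \<forall>n. x n \<in> {0..<p ^ n} \<and> x (Suc n) mod p ^ n = x n},
     monoid.mult = (\<lambda>x y n. (x n * y n) mod p ^ n),
     one = (\<lambda>n. 1 mod p ^ n),
     ring.zero = (\<lambda>n. 0),
     add = (\<lambda>x y n. (x n + y n) mod p ^ n)\<rparr>"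

definition padic_of_int :: "int \<Rightarrow> int \<Rightarrow> (nat \<Rightarrow> int)" where
  "padic_of_int p k = (\<lambda>n. k mod p ^ n)"

text \<open>
  The equation \<open>b u = a\<close> is \<open>u = a / b\<close> in the field of fractions, cleared of denominators; this
  loses nothing because the ring is a domain into which the integers embed (see
  \<open>domain_padic_int\<close> and \<open>inj_padic_of_int\<close> below).
\<close>

definition padic_rational :: "int \<Rightarrow> (nat \<Rightarrow> int) \<Rightarrow> bool" where
  "padic_rational p u \<longleftrightarrow>
    (\<exists>a b. b \<noteq> 0 \<and> padic_of_int p b \<otimes>\<^bsub>padic_int p\<^esub> u = padic_of_int p a)"


section \<open>The map g\<close>

text \<open>
  The definite descriptions are justified by \<open>ex1_eps0\<close> and \<open>ex1_padic_div_p\<close> below.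
\<close>

definition eps0 :: "int \<Rightarrow> (nat \<Rightarrow> int) \<Rightarrow> int" where
  "eps0 p x = (THE e. e \<in> {0..<p} \<and>
     padic_of_int p p divides\<^bsub>padic_int p\<^esub> (padic_of_int p e \<ominus>\<^bsub>padic_int p\<^esub> x))"

text \<open>\<open>x / p\<close>, for \<open>x\<close> divisible by \<open>p\<close>.\<close>

definition padic_div_p :: "int \<Rightarrow> (nat \<Rightarrow> int) \<Rightarrow> (nat \<Rightarrow> int)" where
  "padic_div_p p x =
    (THE y. y \<in> carrier (padic_int p) \<and> padic_of_int p p \<otimes>\<^bsub>padic_int p\<^esub> y = x)"

definition g_map :: "int \<Rightarrow> int \<Rightarrow> (nat \<Rightarrow> int) \<Rightarrow> (nat \<Rightarrow> int)" where
  "g_map p q x =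
    (if padic_of_int p p divides\<^bsub>padic_int p\<^esub> x then padic_div_p p x
     else padic_div_p p
       ((padic_of_int p q \<otimes>\<^bsub>padic_int p\<^esub> x) \<oplus>\<^bsub>padic_int p\<^esub>
        padic_of_int p (eps0 p (\<ominus>\<^bsub>padic_int p\<^esub> (padic_of_int p q \<otimes>\<^bsub>padic_int p\<^esub> x)))))"


section \<open>Ultimately periodic sequences\<close>

definition periodic_seq :: "(nat \<Rightarrow> 'a) \<Rightarrow> bool" where
  "periodic_seq x \<longleftrightarrow> (\<exists>T>0. \<forall>n. x (n + T) = x n)"

definition ultimately_periodic :: "(nat \<Rightarrow> 'a) \<Rightarrow> bool" where
  "ultimately_periodic x \<longleftrightarrow> (\<exists>n0. periodic_seq (\<lambda>n. x (n0 + n)))"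


section \<open>Well-definedness\<close>

lemma carrier_padic_int_iff:
  "x \<in> carrier (padic_int p) \<longleftrightarrow> (\<forall>n. x n \<in> {0..<p ^ n} \<and> x (Suc n) mod p ^ n = x n)"
  by (simp add: padic_int_def)

lemma padic_int_simps:
  "x \<otimes>\<^bsub>padic_int p\<^esub> y = (\<lambda>n. (x n * y n) mod p ^ n)"
  "x \<oplus>\<^bsub>padic_int p\<^esub> y = (\<lambda>n. (x n + y n) mod p ^ n)"
  "\<one>\<^bsub>padic_int p\<^esub> = (\<lambda>n. 1 mod p ^ n)"
  "\<zero>\<^bsub>padic_int p\<^esub> = (\<lambda>n. 0)"
  by (simp_all add: padic_int_def)

lemma padic_carrierI:
  assumes "prime p" "\<And>n. y (Suc n) mod p ^ n = y n mod p ^ n"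
  shows "(\<lambda>n. y n mod p ^ n) \<in> carrier (padic_int p)"
proof -
  have "p > 0" using assms(1) by (simp add: prime_gt_0_int)
  moreover have "(y (Suc n) mod p ^ Suc n) mod p ^ n = y n mod p ^ n" for n
    using assms(2)[of n] by (simp add: mod_mod_cancel)
  ultimately show ?thesis by (simp add: carrier_padic_int_iff)
qed

lemma padic_of_int_closed: "prime p \<Longrightarrow> padic_of_int p k \<in> carrier (padic_int p)"
  unfolding padic_of_int_def by (rule padic_carrierI) auto

lemma padic_nth_mod: "x \<in> carrier (padic_int p) \<Longrightarrow> x n mod p ^ n = x n"
  by (simp add: carrier_padic_int_iff)

lemma padic_nth_le_mod:
  assumes "x \<in> carrier (padic_int p)" "m \<le> n"
  shows "x n mod p ^ m = x m"
  using assms(2)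
proof (induction n rule: dec_induct)
  case base
  show ?case using assms(1) by (simp add: padic_nth_mod)
next
  case (step k)
  have "x (Suc k) mod p ^ m = x (Suc k) mod p ^ k mod p ^ m"
    using step.hyps by (simp add: mod_mod_cancel le_imp_power_dvd)
  then show ?case using step assms(1) by (simp add: carrier_padic_int_iff)
qed

lemma cring_padic_int:
  assumes p: "prime p"
  shows "cring (padic_int p)"
proof (rule cringI)
  have mult_closed: "x \<otimes>\<^bsub>padic_int p\<^esub> y \<in> carrier (padic_int p)"
    and add_closed: "x \<oplus>\<^bsub>padic_int p\<^esub> y \<in> carrier (padic_int p)"
    if "x \<in> carrier (padic_int p)" "y \<in> carrier (padic_int p)" for x y
  proof -
    have *: "x (Suc n) mod p ^ n = x n mod p ^ n" "y (Suc n) mod p ^ n = y n mod p ^ n" for n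
      using that by (auto simp: carrier_padic_int_iff)
    show "x \<otimes>\<^bsub>padic_int p\<^esub> y \<in> carrier (padic_int p)"
      unfolding padic_int_simps by (rule padic_carrierI[OF p]) (rule mod_mult_cong[OF *])
    show "x \<oplus>\<^bsub>padic_int p\<^esub> y \<in> carrier (padic_int p)"
      unfolding padic_int_simps by (rule padic_carrierI[OF p]) (rule mod_add_cong[OF *])
  qed
  have one_closed: "\<one>\<^bsub>padic_int p\<^esub> \<in> carrier (padic_int p)"
    and zero_closed: "\<zero>\<^bsub>padic_int p\<^esub> \<in> carrier (padic_int p)"
    using padic_of_int_closed[OF p, of 1] padic_of_int_closed[OF p, of 0]
    by (simp_all add: padic_of_int_def padic_int_simps)
  show "abelian_group (padic_int p)"
  proof (rule abelian_groupI)
    fix x assume x: "x \<in> carrier (padic_int p)"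
    have "(\<lambda>n. (- x n) mod p ^ n) \<in> carrier (padic_int p)"
      by (rule padic_carrierI[OF p], rule mod_minus_cong)
        (use x in \<open>simp add: carrier_padic_int_iff\<close>)
    then show "\<exists>y\<in>carrier (padic_int p). y \<oplus>\<^bsub>padic_int p\<^esub> x = \<zero>\<^bsub>padic_int p\<^esub>"
      by (rule bexI[rotated]) (simp add: padic_int_simps mod_simps)
    show "\<zero>\<^bsub>padic_int p\<^esub> \<oplus>\<^bsub>padic_int p\<^esub> x = x"
      using x by (simp add: padic_int_simps padic_nth_mod)
  qed (use add_closed zero_closed in \<open>auto simp: padic_int_simps mod_simps algebra_simps\<close>)
  show "Group.comm_monoid (padic_int p)"
  proof (rule comm_monoidI)
    fix x assume x: "x \<in> carrier (padic_int p)"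
    then show "\<one>\<^bsub>padic_int p\<^esub> \<otimes>\<^bsub>padic_int p\<^esub> x = x"
      by (simp add: padic_int_simps padic_nth_mod mod_simps)
  qed (use mult_closed one_closed in \<open>auto simp: padic_int_simps mod_simps algebra_simps\<close>)
qed (auto simp: padic_int_simps mod_simps algebra_simps)

lemma domain_padic_int:
  assumes p: "prime p"
  shows "domain (padic_int p)"
proof (rule domainI[OF cring_padic_int[OF p]])
  have "(1::int) mod p ^ 1 \<noteq> 0" using prime_gt_1_int[OF p] by simp
  then show "\<one>\<^bsub>padic_int p\<^esub> \<noteq> \<zero>\<^bsub>padic_int p\<^esub>"
    unfolding padic_int_simps by metis
next
  fix x y
  assume xy: "x \<otimes>\<^bsub>padic_int p\<^esub> y = \<zero>\<^bsub>padic_int p\<^esub>"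
    and x: "x \<in> carrier (padic_int p)" and y: "y \<in> carrier (padic_int p)"
  show "x = \<zero>\<^bsub>padic_int p\<^esub> \<or> y = \<zero>\<^bsub>padic_int p\<^esub>"
  proof (rule ccontr)
    assume "\<not> ?thesis"
    then obtain m n where mn: "x m \<noteq> 0" "y n \<noteq> 0" by (auto simp: padic_int_simps fun_eq_iff)
    have "\<not> p ^ m dvd x (m + n)" "\<not> p ^ n dvd y (m + n)"
      using mn padic_nth_le_mod[OF x, of m "m + n"] padic_nth_le_mod[OF y, of n "m + n"]
      by (auto simp: dvd_eq_mod_eq_0)
    moreover from this have "\<not> p ^ Suc n dvd y (m + n)"
      by (meson dvd_trans le_imp_power_dvd le_SucI order_refl)
    moreover have "p ^ (m + n) dvd x (m + n) * y (m + n)"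
      using fun_cong[OF xy, of "m + n"] by (simp add: padic_int_simps dvd_eq_mod_eq_0)
    ultimately show False
      using p prime_elem_power_dvd_cases[of p "m + n" "x (m + n)" "y (m + n)" m "Suc n"] by auto
  qed
qed

lemma padic_of_int_hom:
  assumes p: "prime p"
  shows "padic_of_int p \<in> ring_hom \<Z> (padic_int p)"
  using padic_of_int_closed[OF p]
  by (auto intro!: ring_hom_memI simp: padic_of_int_def padic_int_simps mod_simps)

lemma inj_padic_of_int:
  assumes p: "prime p"
  shows "inj (padic_of_int p)"
proof (rule injI)
  fix a b assume ab: "padic_of_int p a = padic_of_int p b"
  obtain n where n: "\<bar>a - b\<bar> < p ^ n"
  proof -
    have "\<bar>a - b\<bar> < 2 ^ nat \<bar>a - b\<bar>"
      using of_nat_less_two_power[of "nat \<bar>a - b\<bar>", where 'a = int] by simp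
    also have "(2::int) ^ nat \<bar>a - b\<bar> \<le> p ^ nat \<bar>a - b\<bar>"
      using prime_ge_2_int[OF p] by (intro power_mono) auto
    finally show ?thesis by (rule that)
  qed
  have "p ^ n dvd a - b"
    using fun_cong[OF ab, of n] by (simp add: padic_of_int_def mod_eq_dvd_iff)
  then show "a = b" using n zdvd_imp_le[of "p ^ n" "\<bar>a - b\<bar>"] by fastforce
qed

lemma padic_p_divides_iff:
  assumes p: "prime p" and x: "x \<in> carrier (padic_int p)"
  shows "padic_of_int p p divides\<^bsub>padic_int p\<^esub> x \<longleftrightarrow> x 1 = 0"
proof
  assume "padic_of_int p p divides\<^bsub>padic_int p\<^esub> x"
  then show "x 1 = 0" by (auto simp: factor_def padic_int_simps padic_of_int_def)
next
  assume x1: "x 1 = 0"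
  have p0: "p > 0" using p by (simp add: prime_gt_0_int)
  define y where "y = (\<lambda>n. x (Suc n) div p)"
  have "y n \<in> {0..<p ^ n} \<and> y (Suc n) mod p ^ n = y n" for n
  proof
    have "x (Suc n) \<in> {0..<p * p ^ n}" using x by (metis carrier_padic_int_iff power_Suc)
    moreover have "p * y n \<le> x (Suc n)"
      using p0 mult_div_mod_eq[of p "x (Suc n)"] pos_mod_sign[of p "x (Suc n)"]
      unfolding y_def by linarith
    ultimately have "p * y n < p * p ^ n" by simp
    then have "y n < p ^ n" using p0 by simp
    then show "y n \<in> {0..<p ^ n}"
      using p0 \<open>x (Suc n) \<in> _\<close> by (simp add: y_def pos_imp_zdiv_nonneg_iff)
    have "x (Suc (Suc n)) mod (p * p ^ n) div p = x (Suc (Suc n)) div p mod p ^ n"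
      using p0 by (simp add: zmod_zmult2_eq)
    moreover have "x (Suc (Suc n)) mod (p * p ^ n) = x (Suc n)"
      using padic_nth_le_mod[OF x, of "Suc n" "Suc (Suc n)"] by simp
    ultimately show "y (Suc n) mod p ^ n = y n" by (simp add: y_def)
  qed
  then have "y \<in> carrier (padic_int p)" by (simp add: carrier_padic_int_iff)
  moreover have "x = padic_of_int p p \<otimes>\<^bsub>padic_int p\<^esub> y"
  proof
    fix n
    have "x (Suc n) mod p = 0" using padic_nth_le_mod[OF x, of 1 "Suc n"] x1 by simp
    then have "p * y n = x (Suc n)" by (auto simp: y_def)
    then show "x n = (padic_of_int p p \<otimes>\<^bsub>padic_int p\<^esub> y) n"
      using padic_nth_le_mod[OF x, of n "Suc n"]
      by (simp add: padic_int_simps padic_of_int_def mod_simps)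
  qed
  ultimately show "padic_of_int p p divides\<^bsub>padic_int p\<^esub> x" by (auto simp: factor_def)
qed

lemma padic_minus_nth:
  assumes p: "prime p" and x: "x \<in> carrier (padic_int p)" and y: "y \<in> carrier (padic_int p)"
  shows "(x \<ominus>\<^bsub>padic_int p\<^esub> y) n = (x n - y n) mod p ^ n"
proof -
  interpret cring "padic_int p" by (rule cring_padic_int[OF p])
  have "(x \<ominus>\<^bsub>padic_int p\<^esub> y) \<oplus>\<^bsub>padic_int p\<^esub> y = x"
    using x y by (simp add: a_minus_def a_assoc l_neg)
  then have "((x \<ominus>\<^bsub>padic_int p\<^esub> y) n + y n) mod p ^ n = x n"
    by (metis padic_int_simps(2))
  then have "(((x \<ominus>\<^bsub>padic_int p\<^esub> y) n + y n) mod p ^ n - y n) mod p ^ n = (x n - y n) mod p ^ n"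
    by simp
  then have "(x \<ominus>\<^bsub>padic_int p\<^esub> y) n mod p ^ n = (x n - y n) mod p ^ n"
    by (simp add: mod_simps)
  then show ?thesis using padic_nth_mod[of "x \<ominus>\<^bsub>padic_int p\<^esub> y" p n] x y by simp
qed

lemma ex1_eps0:
  assumes p: "prime p" and x: "x \<in> carrier (padic_int p)"
  shows "\<exists>!e. e \<in> {0..<p} \<and>
    padic_of_int p p divides\<^bsub>padic_int p\<^esub> (padic_of_int p e \<ominus>\<^bsub>padic_int p\<^esub> x)"
proof -
  interpret cring "padic_int p" by (rule cring_padic_int[OF p])
  have x1: "x 1 \<in> {0..<p}" using x by (metis carrier_padic_int_iff power_one_right)
  have "padic_of_int p p divides\<^bsub>padic_int p\<^esub> (padic_of_int p e \<ominus>\<^bsub>padic_int p\<^esub> x) \<longleftrightarrow> e = x 1"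
    if e: "e \<in> {0..<p}" for e
  proof -
    have "(padic_of_int p e \<ominus>\<^bsub>padic_int p\<^esub> x) 1 = (e - x 1) mod p"
      using padic_minus_nth[OF p padic_of_int_closed[OF p] x, of e 1]
      by (simp add: padic_of_int_def mod_simps)
    moreover have "(e - x 1) mod p = 0 \<longleftrightarrow> e = x 1"
      using e x1 by (auto simp flip: dvd_eq_mod_eq_0 mod_eq_dvd_iff)
    ultimately show ?thesis
      using padic_p_divides_iff[OF p minus_closed[OF padic_of_int_closed[OF p] x]] by simp
  qed
  then show ?thesis using x1 by blast
qed

lemma ex1_padic_div_p:
  assumes p: "prime p" and x: "padic_of_int p p divides\<^bsub>padic_int p\<^esub> x"
  shows "\<exists>!y. y \<in> carrier (padic_int p) \<and> padic_of_int p p \<otimes>\<^bsub>padic_int p\<^esub> y = x"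
proof -
  interpret domain "padic_int p" by (rule domain_padic_int[OF p])
  have "padic_of_int p p \<noteq> \<zero>\<^bsub>padic_int p\<^esub>"
    using injD[OF inj_padic_of_int[OF p], of p 0] p
    by (auto simp: padic_int_simps padic_of_int_def)
  then show ?thesis
    using x m_lcancel[OF _ padic_of_int_closed[OF p]] by (auto simp: factor_def)
qed

lemma g_map_arg_divisible:
  assumes p: "prime p" and x: "x \<in> carrier (padic_int p)"
  shows "padic_of_int p p divides\<^bsub>padic_int p\<^esub>
    ((padic_of_int p q \<otimes>\<^bsub>padic_int p\<^esub> x) \<oplus>\<^bsub>padic_int p\<^esub>
     padic_of_int p (eps0 p (\<ominus>\<^bsub>padic_int p\<^esub> (padic_of_int p q \<otimes>\<^bsub>padic_int p\<^esub> x))))"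
proof -
  interpret cring "padic_int p" by (rule cring_padic_int[OF p])
  define z where "z = padic_of_int p q \<otimes>\<^bsub>padic_int p\<^esub> x"
  have z: "z \<in> carrier (padic_int p)"
    using x padic_of_int_closed[OF p] by (simp add: z_def)
  have "padic_of_int p p divides\<^bsub>padic_int p\<^esub>
      (padic_of_int p (eps0 p (\<ominus>\<^bsub>padic_int p\<^esub> z)) \<ominus>\<^bsub>padic_int p\<^esub> (\<ominus>\<^bsub>padic_int p\<^esub> z))"
    using theI'[OF ex1_eps0[OF p a_inv_closed[OF z]]] by (simp add: eps0_def)
  then show ?thesis
    using z padic_of_int_closed[OF p] by (simp add: a_minus_def a_comm flip: z_def)
qed

lemma g_map_closed:
  assumes p: "prime p" and x: "x \<in> carrier (padic_int p)"
  shows "g_map p q x \<in> carrier (padic_int p)"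
  using theI'[OF ex1_padic_div_p[OF p]] g_map_arg_divisible[OF p x, of q]
  by (auto simp: g_map_def padic_div_p_def)

end

theory Submission
  imports Defs "HOL-Number_Theory.Cong"
begin

text \<open>
  One step of the map is affine with integer coefficients: \<open>p * g x = c * x + e\<close> where
  \<open>c\<close> is \<open>1\<close> or \<open>q\<close> and \<open>0 \<le> e < p\<close> (\<open>g_map_affine\<close>). Both directions of the theorem
  follow from this, because \<open>c \<le> q < p\<close> makes the slope \<open>c / p\<close> less than \<open>1\<close> as a real number.

  If \<open>u = a / b\<close>, then \<open>g u\<close> is a fraction with the same denominator \<open>b\<close>, and its numerator
  \<open>(c * a + e * b) / p\<close> has absolute value at most \<open>((p - 1) * \<bar>a\<bar> + (p - 1) * \<bar>b\<bar>) / p\<close>. A bound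
  \<open>M \<ge> (p - 1) * \<bar>b\<bar>\<close> on the numerators is therefore inherited (\<open>g_map_bounded_numerator\<close>). So the
  orbit of \<open>u\<close> lives in a finite set of fractions, and an orbit in a finite set is ultimately
  periodic.

  Conversely, composing \<open>T\<close> steps gives \<open>p ^ T * g ^ T x = C * x + E\<close> with integers
  \<open>0 < C \<le> q ^ T\<close> and \<open>E\<close> (\<open>g_map_funpow_affine\<close>). If \<open>x\<close> is a point of the orbit with
  \<open>g ^ T x = x\<close>, \<open>T > 0\<close>, then \<open>(p ^ T - C) * x = E\<close>, where \<open>p ^ T - C \<noteq> 0\<close> since \<open>q < p\<close>; so \<open>x\<close> is
  rational. The same affine relation between \<open>u\<close> and \<open>x\<close> then makes \<open>u\<close> rational.

  Identities between p-adic integers are handled as families of congruences modulo \<open>p ^ n\<close>.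
\<close>

section \<open>Orbits of a self-map\<close>

lemma ultimately_periodic_funpow_iff:
  "ultimately_periodic (\<lambda>n. (f ^^ n) u) \<longleftrightarrow> (\<exists>m T. T > 0 \<and> (f ^^ T) ((f ^^ m) u) = (f ^^ m) u)"
proof
  assume "ultimately_periodic (\<lambda>n. (f ^^ n) u)"
  then obtain m T where "T > 0" and per: "\<And>n. (f ^^ (m + (n + T))) u = (f ^^ (m + n)) u"
    by (auto simp: ultimately_periodic_def periodic_seq_def)
  then have "(f ^^ T) ((f ^^ m) u) = (f ^^ m) u"
    using per[of 0] by (simp add: add.commute[of m] funpow_add)
  with \<open>T > 0\<close> show "\<exists>m T. T > 0 \<and> (f ^^ T) ((f ^^ m) u) = (f ^^ m) u" by blast
next
  assume "\<exists>m T. T > 0 \<and> (f ^^ T) ((f ^^ m) u) = (f ^^ m) u"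
  then obtain m T where "T > 0" and T: "(f ^^ T) ((f ^^ m) u) = (f ^^ m) u" by blast
  have "(f ^^ (m + (n + T))) u = (f ^^ (m + n)) u" for n
  proof -
    have "(f ^^ (m + (n + T))) u = (f ^^ (n + (T + m))) u" by (simp add: algebra_simps)
    also have "\<dots> = (f ^^ n) ((f ^^ T) ((f ^^ m) u))" by (simp only: funpow_add o_apply)
    also have "\<dots> = (f ^^ (n + m)) u" by (simp only: T funpow_add o_apply)
    finally show ?thesis by (simp add: add.commute)
  qed
  with \<open>T > 0\<close> show "ultimately_periodic (\<lambda>n. (f ^^ n) u)"
    by (auto simp: ultimately_periodic_def periodic_seq_def)
qed

lemma ultimately_periodic_finite_orbit:
  fixes f :: "'a \<Rightarrow> 'a"
  assumes "finite S" and "\<And>n. (f ^^ n) u \<in> S"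
  shows "ultimately_periodic (\<lambda>n. (f ^^ n) u)"
proof -
  have "finite (range (\<lambda>n. (f ^^ n) u))"
    using assms by (meson finite_subset image_subsetI)
  then have "\<not> inj (\<lambda>n. (f ^^ n) u)"
    using finite_imageD infinite_UNIV_nat by blast
  then obtain i j where "i < j" and eq: "(f ^^ i) u = (f ^^ j) u"
    unfolding inj_on_def by (metis linorder_neqE_nat)
  moreover have "(f ^^ (j - i)) ((f ^^ i) u) = (f ^^ j) u"
    using \<open>i < j\<close> funpow_add[of "j - i" i f] by simp
  ultimately show ?thesis
    unfolding ultimately_periodic_funpow_iff by (metis zero_less_diff)
qed

section \<open>The map as an affine map modulo powers of \<open>p\<close>\<close>

lemma padic_mult_eq_of_int_iff:
  "padic_of_int p b \<otimes>\<^bsub>padic_int p\<^esub> x = padic_of_int p a \<longleftrightarrow> (\<forall>n. [b * x n = a] (mod p ^ n))"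
  by (simp add: padic_int_simps padic_of_int_def fun_eq_iff cong_def mod_simps)

lemma padic_rational_iff_cong:
  "padic_rational p u \<longleftrightarrow> (\<exists>a b. b \<noteq> 0 \<and> (\<forall>n. [b * u n = a] (mod p ^ n)))"
  by (simp add: padic_rational_def padic_mult_eq_of_int_iff)

lemma padic_div_p_cong:
  assumes p: "prime p" and x: "padic_of_int p p divides\<^bsub>padic_int p\<^esub> x"
  shows "[p * padic_div_p p x n = x n] (mod p ^ n)"
proof -
  have "padic_of_int p p \<otimes>\<^bsub>padic_int p\<^esub> padic_div_p p x = x"
    using theI'[OF ex1_padic_div_p[OF p x]] by (simp add: padic_div_p_def)
  then have "x n = (p mod p ^ n * padic_div_p p x n) mod p ^ n"
    by (metis padic_int_simps(1) padic_of_int_def)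
  then show ?thesis by (simp add: cong_def mod_simps)
qed

lemma eps0_range:
  assumes "prime p" and "x \<in> carrier (padic_int p)"
  shows "eps0 p x \<in> {0..<p}"
  using theI'[OF ex1_eps0[OF assms]] by (simp add: eps0_def)

text \<open>
  The two branches of the map in one form: division by \<open>p\<close> is the case \<open>c = 1\<close>, \<open>e = 0\<close>.
\<close>

lemma g_map_affine:
  assumes p: "prime p" and x: "x \<in> carrier (padic_int p)"
  obtains c e where "c = 1 \<or> c = q" "0 \<le> e" "e < p"
    "\<And>n. [p * g_map p q x n = c * x n + e] (mod p ^ n)"
proof (cases "padic_of_int p p divides\<^bsub>padic_int p\<^esub> x")
  case True
  then have "[p * g_map p q x n = 1 * x n + 0] (mod p ^ n)" for n
    using padic_div_p_cong[OF p True, of n] by (simp add: g_map_def)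
  then show ?thesis using that[of 1 0] prime_gt_0_int[OF p] by blast
next
  case False
  interpret cring "padic_int p" by (rule cring_padic_int[OF p])
  define e where "e = eps0 p (\<ominus>\<^bsub>padic_int p\<^esub> (padic_of_int p q \<otimes>\<^bsub>padic_int p\<^esub> x))"
  have e: "e \<in> {0..<p}"
    unfolding e_def using x padic_of_int_closed[OF p] by (intro eps0_range[OF p]) auto
  have "[p * g_map p q x n = q * x n + e] (mod p ^ n)" for n
    using padic_div_p_cong[OF p g_map_arg_divisible[OF p x, of q], of n] False
    unfolding g_map_def e_def[symmetric]
    by (simp add: padic_int_simps padic_of_int_def cong_def mod_simps)
  then show ?thesis using that[of q e] e by auto
qed

lemma g_map_funpow_closed:
  assumes "prime p" and "x \<in> carrier (padic_int p)"
  shows "(g_map p q ^^ n) x \<in> carrier (padic_int p)"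
  using assms by (induction n) (simp_all add: g_map_closed)

lemma padic_cong_Suc:
  assumes "x \<in> carrier (padic_int p)"
  shows "[x (Suc n) = x n] (mod p ^ n)"
  using assms by (simp add: cong_def carrier_padic_int_iff)

section \<open>Orbits of rational points\<close>

text \<open>
  Integrality of the new numerator is read off from the congruence modulo \<open>p\<close>. The bound is inherited because \<open>c \<le> p - 1\<close> and \<open>e \<le> p - 1\<close> give
  \<open>p * \<bar>a'\<bar> \<le> (p - 1) * M + (p - 1) * \<bar>b\<bar> \<le> (p - 1) * M + M\<close>.
\<close>

lemma g_map_bounded_numerator:
  assumes p: "prime p" and q: "1 < q" "q < p" and x: "x \<in> carrier (padic_int p)"
    and M: "(p - 1) * \<bar>b\<bar> \<le> M" and a: "\<bar>a\<bar> \<le> M" and ab: "\<And>n. [b * x n = a] (mod p ^ n)"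
  obtains a' where "\<bar>a'\<bar> \<le> M" "\<And>n. [b * g_map p q x n = a'] (mod p ^ n)"
proof -
  have p0: "p > 0" using p by (simp add: prime_gt_0_int)
  obtain c e where c: "c = 1 \<or> c = q" and e: "0 \<le> e" "e < p"
    and aff: "\<And>n. [p * g_map p q x n = c * x n + e] (mod p ^ n)"
    using g_map_affine[OF p x] by metis
  define k where "k = c * a + e * b"
  have k: "[p * (b * g_map p q x n) = k] (mod p ^ n)" for n
  proof -
    have "[b * (p * g_map p q x n) = b * (c * x n + e)] (mod p ^ n)"
      by (rule cong_scalar_left[OF aff])
    also have "b * (c * x n + e) = c * (b * x n) + e * b" by (simp add: algebra_simps)
    also have "[\<dots> = k] (mod p ^ n)"
      unfolding k_def by (intro cong_add cong_scalar_left ab) simp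
    finally show ?thesis by (simp add: mult.left_commute)
  qed
  have "p dvd k" using k[of 1] by (simp add: cong_def dvd_eq_mod_eq_0)
  then obtain a' where a': "k = p * a'" by blast
  have "[b * g_map p q x n = a'] (mod p ^ n)" for n
  proof -
    \<comment> \<open>Dividing by \<open>p\<close> costs one power of \<open>p\<close>, so level \<open>n\<close> is obtained from level \<open>Suc n\<close>.\<close>
    have "p * p ^ n dvd p * (b * g_map p q x (Suc n) - a')"
      using k[of "Suc n"] by (simp add: a' cong_iff_dvd_diff right_diff_distrib)
    then have "[b * g_map p q x (Suc n) = a'] (mod p ^ n)"
      using p0 by (simp add: cong_iff_dvd_diff)
    moreover have "[b * g_map p q x (Suc n) = b * g_map p q x n] (mod p ^ n)"
      by (intro cong_scalar_left padic_cong_Suc g_map_closed p x)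
    ultimately show ?thesis using cong_sym cong_trans by blast
  qed
  moreover have "\<bar>a'\<bar> \<le> M"
  proof -
    have "p * \<bar>a'\<bar> = \<bar>c * a + e * b\<bar>" using p0 a' by (simp add: k_def abs_mult)
    also have "\<dots> \<le> \<bar>c\<bar> * \<bar>a\<bar> + \<bar>e\<bar> * \<bar>b\<bar>" by (metis abs_mult abs_triangle_ineq)
    also have "\<dots> \<le> (p - 1) * M + (p - 1) * \<bar>b\<bar>"
      using c e q a by (intro add_mono mult_mono) auto
    also have "\<dots> \<le> (p - 1) * M + M" using M by simp
    also have "\<dots> = p * M" by (simp add: algebra_simps)
    finally show ?thesis using p0 by simp
  qed
  ultimately show ?thesis using that by blast
qed

text \<open>
  Multiplication by \<open>b \<noteq> 0\<close> is injective in a domain, and it sends the fractions with denominator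
  \<open>b\<close> to their numerators.
\<close>

lemma finite_bounded_fractions:
  assumes p: "prime p" and b: "b \<noteq> 0"
  shows "finite {x \<in> carrier (padic_int p). \<exists>a. \<bar>a\<bar> \<le> M \<and> (\<forall>n. [b * x n = a] (mod p ^ n))}"
    (is "finite ?S")
proof (rule inj_on_finite)
  interpret domain "padic_int p" by (rule domain_padic_int[OF p])
  let ?f = "\<lambda>x. padic_of_int p b \<otimes>\<^bsub>padic_int p\<^esub> x"
  have "padic_of_int p b \<noteq> \<zero>\<^bsub>padic_int p\<^esub>"
    using injD[OF inj_padic_of_int[OF p], of b 0] b
    by (auto simp: padic_int_simps padic_of_int_def)
  then show "inj_on ?f ?S"
    using m_lcancel[OF _ padic_of_int_closed[OF p]] by (auto simp: inj_on_def)
  have "?f x \<in> padic_of_int p ` {-M..M}" if "x \<in> ?S" for x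
    using that unfolding padic_mult_eq_of_int_iff[symmetric]
    by (auto simp: abs_le_iff intro!: imageI)
  then show "?f ` ?S \<subseteq> padic_of_int p ` {-M..M}" by blast
  show "finite (padic_of_int p ` {-M..M})" by simp
qed

lemma rational_imp_ultimately_periodic:
  assumes p: "prime p" and q: "1 < q" "q < p" and u: "u \<in> carrier (padic_int p)"
    and rat: "padic_rational p u"
  shows "ultimately_periodic (\<lambda>n. (g_map p q ^^ n) u)"
proof -
  obtain a b where b: "b \<noteq> 0" and ab: "\<And>n. [b * u n = a] (mod p ^ n)"
    using rat by (auto simp: padic_rational_iff_cong)
  define M where "M = max \<bar>a\<bar> ((p - 1) * \<bar>b\<bar>)"
  have num: "\<exists>a. \<bar>a\<bar> \<le> M \<and> (\<forall>n. [b * (g_map p q ^^ m) u n = a] (mod p ^ n))" for m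
  proof (induction m)
    case 0
    show ?case using ab by (intro exI[of _ a]) (simp add: M_def)
  next
    case (Suc m)
    then obtain a where "\<bar>a\<bar> \<le> M" "\<And>n. [b * (g_map p q ^^ m) u n = a] (mod p ^ n)" by blast
    then obtain a' where "\<bar>a'\<bar> \<le> M"
      "\<And>n. [b * g_map p q ((g_map p q ^^ m) u) n = a'] (mod p ^ n)"
      using g_map_bounded_numerator[OF p q g_map_funpow_closed[OF p u], of b M a m]
      by (auto simp: M_def)
    then show ?case by auto
  qed
  show ?thesis
    using num g_map_funpow_closed[OF p u]
    by (intro ultimately_periodic_finite_orbit[OF finite_bounded_fractions[OF p b, of M]]) blast
qed

section \<open>Rationality from periodicity\<close>

lemma g_map_funpow_affine:
  assumes p: "prime p" and q: "1 < q" and x: "x \<in> carrier (padic_int p)"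
  shows "\<exists>C E. 0 < C \<and> C \<le> q ^ T \<and> (\<forall>n. [p ^ T * (g_map p q ^^ T) x n = C * x n + E] (mod p ^ n))"
proof (induction T)
  case 0
  show ?case by (intro exI[of _ 1] exI[of _ 0]) simp
next
  case (Suc T)
  define y where "y = (g_map p q ^^ T) x"
  obtain C E where C: "0 < C" "C \<le> q ^ T"
    and CE: "\<And>n. [p ^ T * y n = C * x n + E] (mod p ^ n)"
    using Suc unfolding y_def by blast
  obtain c e where c: "c = 1 \<or> c = q"
    and ce: "\<And>n. [p * g_map p q y n = c * y n + e] (mod p ^ n)"
    using g_map_affine[OF p g_map_funpow_closed[OF p x]] unfolding y_def by metis
  have "[p ^ Suc T * g_map p q y n = (c * C) * x n + (c * E + p ^ T * e)] (mod p ^ n)" for n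
  proof -
    have "p ^ Suc T * g_map p q y n = p ^ T * (p * g_map p q y n)" by simp
    also have "[\<dots> = p ^ T * (c * y n + e)] (mod p ^ n)" by (rule cong_scalar_left[OF ce])
    also have "p ^ T * (c * y n + e) = c * (p ^ T * y n) + p ^ T * e"
      by (simp add: algebra_simps)
    also have "[\<dots> = c * (C * x n + E) + p ^ T * e] (mod p ^ n)"
      by (intro cong_add cong_scalar_left CE) simp
    finally show ?thesis by (simp add: algebra_simps)
  qed
  moreover have "0 < c * C" using c C q by auto
  moreover have "c * C \<le> q ^ Suc T"
    unfolding power_Suc using c C q by (intro mult_mono) auto
  ultimately show ?case by (auto simp: y_def)
qed

lemma ultimately_periodic_imp_rational:
  assumes p: "prime p" and q: "1 < q" "q < p" and u: "u \<in> carrier (padic_int p)"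
    and per: "ultimately_periodic (\<lambda>n. (g_map p q ^^ n) u)"
  shows "padic_rational p u"
proof -
  obtain m T where "T > 0" and T: "(g_map p q ^^ T) ((g_map p q ^^ m) u) = (g_map p q ^^ m) u"
    using per unfolding ultimately_periodic_funpow_iff by blast
  define x where "x = (g_map p q ^^ m) u"
  have x: "x \<in> carrier (padic_int p)" and Tx: "(g_map p q ^^ T) x = x"
    using g_map_funpow_closed[OF p u] T by (simp_all add: x_def)
  obtain C E where C: "C \<le> q ^ T" and CE: "\<And>n. [p ^ T * x n = C * x n + E] (mod p ^ n)"
    using g_map_funpow_affine[OF p q(1) x, of T] Tx by auto
  obtain D F where D: "0 < D" and DF: "\<And>n. [p ^ m * x n = D * u n + F] (mod p ^ n)"
    using g_map_funpow_affine[OF p q(1) u, of m] unfolding x_def by blast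
  define B where "B = p ^ T - C"
  have "q ^ T < p ^ T" using q \<open>T > 0\<close> by (intro power_strict_mono) auto
  then have "B * D \<noteq> 0" using C D by (simp add: B_def)
  moreover have "[(B * D) * u n = p ^ m * E - B * F] (mod p ^ n)" for n
  proof -
    have "p ^ n dvd B * x n - E"
      using CE[of n] by (simp add: B_def cong_iff_dvd_diff algebra_simps)
    moreover have "p ^ n dvd p ^ m * x n - (D * u n + F)"
      using DF[of n] by (simp add: cong_iff_dvd_diff)
    ultimately have "p ^ n dvd p ^ m * (B * x n - E) - B * (p ^ m * x n - (D * u n + F))"
      by (rule dvd_diff[OF dvd_mult dvd_mult])
    also have "\<dots> = (B * D) * u n - (p ^ m * E - B * F)" by (simp add: algebra_simps)
    finally show ?thesis by (simp add: cong_iff_dvd_diff)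
  qed
  ultimately show ?thesis unfolding padic_rational_iff_cong by blast
qed

section \<open>The equivalence\<close>

theorem mainTheorem1:
  fixes p q :: int and u :: "nat \<Rightarrow> int"
  assumes "prime p"
    and "1 < q" and "q < p"
    and "u \<in> carrier (padic_int p)"
  shows "padic_rational p u \<longleftrightarrow> ultimately_periodic (\<lambda>n. (g_map p q ^^ n) u)"
  using rational_imp_ultimately_periodic ultimately_periodic_imp_rational assms by blast

end
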